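(* Let $(\mathcal{M},d,0)$ be a pointed metric space and let $\alpha\colon(0,\infty)\to(0,\infty)$ be a Lipschitz map with $D(\alpha)(K(\alpha)+2)\le1$. Equip the real Banach space $\mathrm{Lip}_0(\mathcal{M})$ with the multiplication $\odot_\alpha$. The norm and weak$^*$ topologies of $(\mathrm{Lip}_0(\mathcal{M}))^*$ coincide on $\Delta_0^*(\mathcal{M})$. Moreover, if $\mathrm{Lip}_0(\mathcal{M})$ has a natural unit, then $0$ is an isolated point of $\Delta_0^*(\mathcal{M})$.
   Context: All spaces are real. $\mathrm{Lip}_0(\mathcal{M})$ is the Banach space of real Lipschitz functions on $\mathcal{M}$ vanishing at the base point $0$, with norm $\mathrm{Lip}(f)=\sup_{x\neq y}|f(x)-f(y)|/d(x,y)$. One has $\mathrm{Lip}_0(\mathcal{M})=\mathcal{F}(\mathcal{M})^*$, where $\mathcal{F}(\mathcal{M})$ is the Lipschitz-free space over $\mathcal{M}$, i.e. the closed linear span in $\mathrm{Lip}_0(\mathcal{M})^*$ of the evaluations $\delta_{\mathcal{M}}(x)\colon f\mapsto f(x)$. The weak$^*$ topology of $(\mathrm{Lip}_0(\mathcal{M}))^*$ is that of pointwise convergence on $\mathrm{Lip}_0(\mathcal{M})$. $\mathrm{Lip}(\alpha)$ is the least Lipschitz constant of $\alpha$, $D(\alpha)=\sup_{t>0}t/\alpha(t)$, $K(\alpha)=\mathrm{Lip}(\alpha)D(\alpha)$. Put $\zeta(0)=0$ and $\zeta(x)=\alpha(d(0,x))$ for $x\neq0$. The product is $(f\odot_\alpha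 g)(x)=f(x)g(x)/\zeta(x)$ for $x\ne0$ and $(f\odot_\alpha g)(0)=0$; it makes $\mathrm{Lip}_0(\mathcal{M})$ a Banach algebra. "Natural unit" means that this algebra has a unit (necessarily $\zeta$). $\Delta(\mathcal{M})$ is the set of all nonzero algebra homomorphisms (linear and multiplicative maps) from $(\mathrm{Lip}_0(\mathcal{M}),\odot_\alpha)$ into $\mathbb{R}$; $\Delta_0(\mathcal{M})=\Delta(\mathcal{M})\cup\{0\}$; $\Delta_0^*(\mathcal{M})$ is the set of members of $\Delta_0(\mathcal{M})$ that are $w^*$-continuous on $\mathrm{Lip}_0(\mathcal{M})=\mathcal{F}(\mathcal{M})^*$. (Algebra homomorphisms into $\mathbb{R}$ are automatically bounded.) *)

theory Defs
  imports "HOL-Analysis.Analysis"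
begin

section \<open>Lipschitz functions on a pointed metric space\<close>

class pointed_metric_space = metric_space +
  fixes base_point :: 'a

text \<open>
  The supremum of all difference quotients over a nonempty set, which is the least Lipschitz
  constant of a Lipschitz function. The diagonal pairs contribute \<open>0 / 0 = 0\<close>, so the value is
  \<open>0\<close> on a singleton.
\<close>

definition Lip :: "'a::metric_space set \<Rightarrow> ('a \<Rightarrow> real) \<Rightarrow> real" where
  "Lip S f = (SUP (x, y)\<in>S \<times> S. \<bar>f x - f y\<bar> / dist x y)"

lemma bdd_above_Lip:
  assumes "L-lipschitz_on S f"
  shows "bdd_above ((\<lambda>(x, y). \<bar>f x - f y\<bar> / dist x y) ` (S \<times> S))"
proof (rule bdd_aboveI2[where M = L])
  fix p assume "p \<in> S \<times> S"
  then obtain x y where p: "p = (x, y)" "x \<in> S" "y \<in> S" by auto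
  have "\<bar>f x - f y\<bar> \<le> L * dist x y" "0 \<le> L"
    using assms p by (auto simp: lipschitz_on_def dist_real_def)
  then show "(case p of (x, y) \<Rightarrow> \<bar>f x - f y\<bar> / dist x y) \<le> L"
    by (cases "x = y") (auto simp: p field_simps)
qed

lemma Lip_nonneg:
  assumes "L-lipschitz_on S f" "S \<noteq> {}"
  shows "0 \<le> Lip S f"
proof -
  obtain x where "x \<in> S" using assms by auto
  then show ?thesis
    unfolding Lip_def
    using cSUP_upper[OF _ bdd_above_Lip[OF assms(1)], of "(x, x)"] by simp
qed

lemma abs_diff_le_Lip:
  assumes "L-lipschitz_on S f" "x \<in> S" "y \<in> S"
  shows "\<bar>f x - f y\<bar> \<le> Lip S f * dist x y"
proof (cases "x = y")
  case False
  have "\<bar>f x - f y\<bar> / dist x y \<le> Lip S f"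
    unfolding Lip_def
    using cSUP_upper[OF _ bdd_above_Lip[OF assms(1)], of "(x, y)"] assms by simp
  with False show ?thesis by (simp add: field_simps)
qed simp

lemma Lip_least:
  assumes "L-lipschitz_on S f" "S \<noteq> {}"
  shows "Lip S f \<le> L"
  unfolding Lip_def
proof (rule cSUP_least)
  fix p assume "p \<in> S \<times> S"
  then obtain x y where p: "p = (x, y)" "x \<in> S" "y \<in> S" by auto
  have "\<bar>f x - f y\<bar> \<le> L * dist x y" "0 \<le> L"
    using assms p by (auto simp: lipschitz_on_def dist_real_def)
  then show "(case p of (x, y) \<Rightarrow> \<bar>f x - f y\<bar> / dist x y) \<le> L"
    by (cases "x = y") (auto simp: p field_simps)
qed (use assms in simp)

lemma lipschitz_on_Lip:
  assumes "L-lipschitz_on S f" "S \<noteq> {}"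
  shows "(Lip S f)-lipschitz_on S f"
  by (rule lipschitz_onI)
    (use abs_diff_le_Lip[OF assms(1)] Lip_nonneg[OF assms] in \<open>auto simp: dist_real_def\<close>)

typedef (overloaded) 'a lip0 =
  "{f :: 'a::pointed_metric_space \<Rightarrow> real. f base_point = 0 \<and> (\<exists>L. L-lipschitz_on UNIV f)}"
  morphisms lip0_apply Lip0
  by (rule exI[of _ "\<lambda>_. 0"]) (auto intro!: exI[of _ 0] simp: lipschitz_on_def)

setup_lifting type_definition_lip0

lemma lip0_eqI: "(\<And>x. lip0_apply f x = lip0_apply g x) \<Longrightarrow> f = g"
  by transfer auto

lemma lip0_apply_base [simp]: "lip0_apply f base_point = 0"
  using lip0_apply[of f] by simp

lemma lip0_lipschitz: "(Lip UNIV (lip0_apply f))-lipschitz_on UNIV (lip0_apply f)"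
  using lip0_apply[of f] by (auto intro: lipschitz_on_Lip)

instantiation lip0 :: (pointed_metric_space) real_vector
begin

lift_definition zero_lip0 :: "'a lip0" is "\<lambda>_. 0"
  by (auto intro!: exI[of _ 0] simp: lipschitz_on_def)

lift_definition plus_lip0 :: "'a lip0 \<Rightarrow> 'a lip0 \<Rightarrow> 'a lip0" is "\<lambda>f g x. f x + g x"
  by (auto intro: lipschitz_on_add)

lift_definition uminus_lip0 :: "'a lip0 \<Rightarrow> 'a lip0" is "\<lambda>f x. - f x"
  by (auto intro: lipschitz_on_minus)

lift_definition minus_lip0 :: "'a lip0 \<Rightarrow> 'a lip0 \<Rightarrow> 'a lip0" is "\<lambda>f g x. f x - g x"
  by (auto intro: lipschitz_on_diff)

lift_definition scaleR_lip0 :: "real \<Rightarrow> 'a lip0 \<Rightarrow> 'a lip0" is "\<lambda>c f x. c * f x"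
  by (auto intro: lipschitz_on_cmult_real)

instance
  by standard (transfer; auto simp: algebra_simps)+

end

instantiation lip0 :: (pointed_metric_space) real_normed_vector
begin

lift_definition norm_lip0 :: "'a lip0 \<Rightarrow> real" is "Lip UNIV" .

definition dist_lip0 :: "'a lip0 \<Rightarrow> 'a lip0 \<Rightarrow> real" where
  "dist_lip0 f g = norm (f - g)"

definition uniformity_lip0 :: "('a lip0 \<times> 'a lip0) filter" where
  "uniformity_lip0 = (INF e\<in>{0 <..}. principal {(x, y). dist x y < e})"

definition open_lip0 :: "'a lip0 set \<Rightarrow> bool" where
  "open_lip0 S = (\<forall>x\<in>S. \<forall>\<^sub>F (x', y) in uniformity. x' = x \<longrightarrow> y \<in> S)"

definition sgn_lip0 :: "'a lip0 \<Rightarrow> 'a lip0" where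
  "sgn_lip0 f = inverse (norm f) *\<^sub>R f"

instance
proof
  have nonneg: "0 \<le> norm f" for f :: "'a lip0"
    using Lip_nonneg[OF lip0_lipschitz[of f]] by (simp add: norm_lip0.rep_eq)
  have le: "\<bar>lip0_apply f x - lip0_apply f y\<bar> \<le> norm f * dist x y" for f :: "'a lip0" and x y
    using abs_diff_le_Lip[OF lip0_lipschitz[of f]] by (simp add: norm_lip0.rep_eq)
  have least: "norm f \<le> L"
    if "0 \<le> L" "\<And>x y. \<bar>lip0_apply f x - lip0_apply f y\<bar> \<le> L * dist x y" for f :: "'a lip0" and L
    unfolding norm_lip0.rep_eq
    by (rule Lip_least) (use that in \<open>auto simp: lipschitz_on_def dist_real_def\<close>)
  fix f g :: "'a lip0" and c :: real
  show "norm f = 0 \<longleftrightarrow> f = 0"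
  proof
    assume "norm f = 0"
    then show "f = 0"
      using le[of f _ base_point] by (auto intro!: lip0_eqI simp: zero_lip0.rep_eq)
  next
    assume "f = 0"
    then have "norm f \<le> 0" by (auto intro!: least simp: zero_lip0.rep_eq)
    with nonneg[of f] show "norm f = 0" by simp
  qed
  show "norm (f + g) \<le> norm f + norm g"
  proof (rule least)
    fix x y
    show "\<bar>lip0_apply (f + g) x - lip0_apply (f + g) y\<bar> \<le> (norm f + norm g) * dist x y"
      using le[of f x y] le[of g x y] by (simp add: plus_lip0.rep_eq algebra_simps)
  qed (simp add: nonneg)
  have scale: "norm (c *\<^sub>R f) \<le> \<bar>c\<bar> * norm f" for c and f :: "'a lip0"
  proof (rule least)
    fix x y
    show "\<bar>lip0_apply (c *\<^sub>R f) x - lip0_apply (c *\<^sub>R f) y\<bar> \<le> \<bar>c\<bar> * norm f * dist x y"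
      using mult_left_mono[OF le[of f x y], of "\<bar>c\<bar>"]
      by (simp add: scaleR_lip0.rep_eq abs_mult mult.assoc flip: right_diff_distrib)
  qed (simp add: nonneg)
  show "norm (c *\<^sub>R f) = \<bar>c\<bar> * norm f"
  proof (cases "c = 0")
    case True
    then show ?thesis using scale[of c f] nonneg[of "c *\<^sub>R f"] by simp
  next
    case False
    have "norm f \<le> \<bar>inverse c\<bar> * norm (c *\<^sub>R f)"
      using scale[of "inverse c" "c *\<^sub>R f"] False by simp
    with False have "\<bar>c\<bar> * norm f \<le> norm (c *\<^sub>R f)"
      by (simp add: field_simps)
    with scale[of c f] show ?thesis by simp
  qed
qed (rule dist_lip0_def uniformity_lip0_def open_lip0_def sgn_lip0_def)+

end

lemma abs_lip0_le: "\<bar>lip0_apply f x\<bar> \<le> norm f * dist base_point x"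
  using abs_diff_le_Lip[OF lip0_lipschitz[of f], of x base_point]
  by (simp add: norm_lip0.rep_eq dist_commute)

section \<open>The Lipschitz-free space and the weak-star topologies\<close>

lift_definition delta :: "'a::pointed_metric_space \<Rightarrow> 'a lip0 \<Rightarrow>\<^sub>L real" is
  "\<lambda>x f. lip0_apply f x"
proof -
  fix x :: 'a
  show "bounded_linear (\<lambda>f. lip0_apply f x)"
    by (rule bounded_linear_intro[where K = "dist base_point x"])
      (auto simp: plus_lip0.rep_eq scaleR_lip0.rep_eq abs_lip0_le)
qed

definition lipschitz_free_space :: "('a::pointed_metric_space lip0 \<Rightarrow>\<^sub>L real) set" where
  "lipschitz_free_space = closure (span (range delta))"

text \<open>
  Under the identification of \<^typ>\<open>'a lip0\<close> with the dual of the Lipschitz-free space, \<open>f\<close> is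
  the functional \<open>m \<mapsto> m f\<close>; the weak-star topology is pointwise convergence of these
  functionals on the free space.
\<close>

definition lip0_weak_star :: "'a::pointed_metric_space lip0 topology" where
  "lip0_weak_star =
    pullback_topology UNIV (\<lambda>f. \<lambda>m\<in>lipschitz_free_space. blinfun_apply m f)
      (product_topology (\<lambda>_. euclideanreal) lipschitz_free_space)"

text \<open>
  On a dual space \<^typ>\<open>'b::real_normed_vector \<Rightarrow>\<^sub>L real\<close> the library's strong operator topology is
  pointwise convergence on \<^typ>\<open>'b::real_normed_vector\<close>, that is, the weak-star topology.
\<close>

abbreviation dual_weak_star :: "('b::real_normed_vector \<Rightarrow>\<^sub>L real) topology" where
  "dual_weak_star \<equiv> strong_operator_topology"

section \<open>The algebra\<close>

text \<open>
  The supremum \<open>D \<alpha>\<close> may be infinite, so \<open>D\<close> and \<open>K\<close> are extended reals. For Lipschitz \<open>\<alpha>\<close> and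
  infinite \<open>D \<alpha>\<close> the product \<open>D \<alpha> * (K \<alpha> + 2)\<close> is infinite, also when
  \<open>K \<alpha> = 0 * \<infinity> = 0\<close>.
\<close>

definition D :: "(real \<Rightarrow> real) \<Rightarrow> ereal" where
  "D \<alpha> = (SUP t\<in>{0<..}. ereal (t / \<alpha> t))"

definition K :: "(real \<Rightarrow> real) \<Rightarrow> ereal" where
  "K \<alpha> = ereal (Lip {0<..} \<alpha>) * D \<alpha>"

definition zeta :: "(real \<Rightarrow> real) \<Rightarrow> 'a::pointed_metric_space \<Rightarrow> real" where
  "zeta \<alpha> x = (if x = base_point then 0 else \<alpha> (dist base_point x))"

text \<open>
  The product below is meaningful only if it is a Lipschitz function;
  \<open>lip0_apply_lip0_mult\<close> shows that this is so whenever \<open>\<alpha>\<close> is positive and Lipschitz and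
  \<open>D \<alpha>\<close> is finite.
\<close>

definition lip0_mult ::
    "(real \<Rightarrow> real) \<Rightarrow> 'a::pointed_metric_space lip0 \<Rightarrow> 'a lip0 \<Rightarrow> 'a lip0" where
  "lip0_mult \<alpha> f g =
    Lip0 (\<lambda>x. if x = base_point then 0 else lip0_apply f x * lip0_apply g x / zeta \<alpha> x)"

lemma lip0_apply_lip0_mult:
  fixes f g :: "'a::pointed_metric_space lip0"
  assumes pos: "\<And>t. 0 < t \<Longrightarrow> 0 < \<alpha> t"
    and lip: "L-lipschitz_on {0<..} \<alpha>"
    and fin: "D \<alpha> < \<infinity>"
  shows "lip0_apply (lip0_mult \<alpha> f g) x =
    (if x = base_point then 0 else lip0_apply f x * lip0_apply g x / zeta \<alpha> x)"
proof -
  let ?h = "\<lambda>x. if x = base_point then 0 else lip0_apply f x * lip0_apply g x / zeta \<alpha> x"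
  let ?F = "norm f" and ?G = "norm g"
  have L0: "0 \<le> L" using lip by (rule lipschitz_on_nonneg)
  have "ereal (1 / \<alpha> 1) \<le> D \<alpha>"
    unfolding D_def by (rule SUP_upper) simp
  then have "D \<alpha> \<noteq> -\<infinity>" by auto
  with fin obtain d where d: "D \<alpha> = ereal d" by (cases "D \<alpha>") auto
  have dub: "t / \<alpha> t \<le> d" if "0 < t" for t
  proof -
    have "ereal (t / \<alpha> t) \<le> D \<alpha>"
      unfolding D_def by (rule SUP_upper) (use that in simp)
    with d show ?thesis by simp
  qed
  have d0: "0 \<le> d" using dub[of 1] pos[of 1] by (smt (verit) divide_nonneg_pos)
  have zpos: "0 < zeta \<alpha> x" if "x \<noteq> base_point" for x :: 'a
    using that pos[of "dist base_point x"] by (simp add: zeta_def)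
  have quot: "\<bar>lip0_apply k x / zeta \<alpha> x\<bar> \<le> norm k * d"
    if "x \<noteq> base_point" for k :: "'a lip0" and x
  proof -
    have "\<bar>lip0_apply k x / zeta \<alpha> x\<bar> = \<bar>lip0_apply k x\<bar> / zeta \<alpha> x"
      using zpos[OF that] by (simp add: abs_divide)
    also have "\<dots> \<le> norm k * dist base_point x / zeta \<alpha> x"
      using zpos[OF that] by (intro divide_right_mono abs_lip0_le) auto
    also have "\<dots> = norm k * (dist base_point x / \<alpha> (dist base_point x))"
      using that by (simp add: zeta_def)
    also have "\<dots> \<le> norm k * d"
      using that by (intro mult_left_mono dub) auto
    finally show ?thesis .
  qed
  have diff: "\<bar>lip0_apply k x - lip0_apply k y\<bar> \<le> norm k * dist x y" for k :: "'a lip0" and x y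
    using abs_diff_le_Lip[OF lip0_lipschitz[of k], of x y] by (simp add: norm_lip0.rep_eq)
  have zdiff: "\<bar>zeta \<alpha> y - zeta \<alpha> x\<bar> \<le> L * dist x y"
    if "x \<noteq> base_point" "y \<noteq> base_point" for x y :: 'a
  proof -
    have "\<bar>\<alpha> (dist base_point y) - \<alpha> (dist base_point x)\<bar>
        \<le> L * \<bar>dist base_point y - dist base_point x\<bar>"
      using lipschitz_onD[OF lip, of "dist base_point y" "dist base_point x"] that
      by (simp add: dist_real_def)
    also have "\<dots> \<le> L * dist x y"
    proof (rule mult_left_mono[OF _ L0])
      show "\<bar>dist base_point y - dist base_point x\<bar> \<le> dist x y"
        using dist_triangle[of base_point y x] dist_triangle[of base_point x y]
        by (simp add: dist_commute abs_le_iff)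
    qed
    finally show ?thesis using that by (simp add: zeta_def)
  qed
  let ?C = "?F * (?G * d) + ?F * d * ?G + (?F * d) * (?G * d) * L"
  have C0: "0 \<le> ?C" using L0 d0 by simp
  have base: "\<bar>?h x\<bar> \<le> ?C * dist x base_point" for x
  proof (cases "x = base_point")
    case False
    have "\<bar>?h x\<bar> = \<bar>lip0_apply f x\<bar> * \<bar>lip0_apply g x / zeta \<alpha> x\<bar>"
      using False by (simp add: abs_mult)
    also have "\<dots> \<le> (?F * dist base_point x) * (?G * d)"
      by (intro mult_mono abs_lip0_le quot False) auto
    also have "\<dots> = (?F * (?G * d)) * dist x base_point"
      by (simp add: dist_commute mult_ac)
    also have "\<dots> \<le> ?C * dist x base_point"
      using L0 d0 by (intro mult_right_mono) auto
    finally show ?thesis .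
  qed simp
  have "\<bar>?h x - ?h y\<bar> \<le> ?C * dist x y" for x y
  proof (cases "x = base_point \<or> y = base_point")
    case True
    then show ?thesis using base[of x] base[of y] by (auto simp: dist_commute)
  next
    case False
    then have x: "x \<noteq> base_point" and y: "y \<noteq> base_point" by auto
    define a b a' b' z w where
      "a = lip0_apply f x" "b = lip0_apply g x" "a' = lip0_apply f y" "b' = lip0_apply g y"
      "z = zeta \<alpha> x" "w = zeta \<alpha> y"
    note defs = this
    have zw: "0 < z" "0 < w" using zpos[OF x] zpos[OF y] by (simp_all add: defs)
    have "?h x - ?h y = a * b / z - a' * b' / w"
      using x y by (simp add: defs)
    also have "\<dots> = (a - a') * (b / z) + (a' / w) * (b - b') + (a' / w) * (b / z) * (w - z)"
      using zw by (simp add: field_simps)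
    also have "\<bar>\<dots>\<bar> \<le> \<bar>a - a'\<bar> * \<bar>b / z\<bar> + \<bar>a' / w\<bar> * \<bar>b - b'\<bar> + \<bar>a' / w\<bar> * \<bar>b / z\<bar> * \<bar>w - z\<bar>"
      by (intro order_trans[OF abs_triangle_ineq] add_mono) (auto simp: abs_mult)
    also have "\<dots> \<le> (?F * dist x y) * (?G * d) + (?F * d) * (?G * dist x y)
        + (?F * d) * (?G * d) * (L * dist x y)"
      unfolding defs
      by (intro add_mono mult_mono diff quot zdiff x y) (use d0 in auto)
    also have "\<dots> = ?C * dist x y" by (simp add: algebra_simps)
    finally show ?thesis .
  qed
  then have "?C-lipschitz_on UNIV ?h"
    using C0 by (auto simp: lipschitz_on_def dist_real_def)
  then have "?h \<in> {f. f base_point = 0 \<and> (\<exists>L. L-lipschitz_on UNIV f)}"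
    by (intro CollectI conjI exI[where x = ?C]) simp_all
  from Lip0_inverse[OF this] show ?thesis
    unfolding lip0_mult_def by simp
qed

definition has_natural_unit ::
    "'a::pointed_metric_space itself \<Rightarrow> (real \<Rightarrow> real) \<Rightarrow> bool" where
  "has_natural_unit _ \<alpha> \<longleftrightarrow>
    (\<exists>e :: 'a lip0. \<forall>f. lip0_mult \<alpha> e f = f \<and> lip0_mult \<alpha> f e = f)"

section \<open>The spectrum\<close>

definition Delta :: "(real \<Rightarrow> real) \<Rightarrow> ('a::pointed_metric_space lip0 \<Rightarrow> real) set" where
  "Delta \<alpha> = {\<phi>. linear \<phi> \<and> (\<forall>f g. \<phi> (lip0_mult \<alpha> f g) = \<phi> f * \<phi> g) \<and> \<phi> \<noteq> (\<lambda>_. 0)}"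

definition Delta0 :: "(real \<Rightarrow> real) \<Rightarrow> ('a::pointed_metric_space lip0 \<Rightarrow> real) set" where
  "Delta0 \<alpha> = insert (\<lambda>_. 0) (Delta \<alpha>)"

text \<open>
  Weak-star continuous functionals are norm continuous, so nothing is lost by taking the
  following set inside the topological dual.
\<close>

definition Delta0_star ::
    "(real \<Rightarrow> real) \<Rightarrow> ('a::pointed_metric_space lip0 \<Rightarrow>\<^sub>L real) set" where
  "Delta0_star \<alpha> =
    {\<phi>. blinfun_apply \<phi> \<in> Delta0 \<alpha> \<and>
        continuous_map lip0_weak_star euclideanreal (blinfun_apply \<phi>)}"

end

theory Submission
  imports Defs
begin

text \<open>
  Write \<open>e\<^sub>x f = f x / \<zeta> x\<close> for \<open>x\<close> other than the base point. These normalized evaluations are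
  characters, and up to limits they are all of them. There are two kinds of limit.

  For pointwise limits (\<open>character_approx\<close>) the reason is that the algebra is closed under
  division by functions bounded away from zero. If a character \<open>\<phi>\<close> were
  separated from all \<open>e\<^sub>x\<close> by finitely many functions \<open>f\<close>, then
  \<open>u x = \<Sum>\<^sub>f (e\<^sub>x f - \<phi> f)\<^sup>2\<close> would be bounded below, so with \<open>h\<close> also \<open>h / u\<close> would be a Lipschitz
  function; but \<open>\<phi> (h u) = 0\<close>, and \<open>h \<odot> h = (h u) \<odot> (h / u)\<close> gives \<open>\<phi> h = 0\<close> for all \<open>h\<close>.
  As a consequence, closed inequalities that hold for all \<open>e\<^sub>x\<close> hold for all characters.
  One of them is \<open>\<bar>\<phi> f\<bar> \<le> \<parallel>f\<parallel> \<phi> \<rho>\<close>, where \<open>\<rho>\<close> is the distance to the base point: the value at the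
  single function \<open>\<rho>\<close> controls the norm, which settles weak-star neighbourhoods of \<open>0\<close>.

  A nonzero weak-star continuous character is even a norm limit of normalized evaluations
  (\<open>weak_star_character_near_evaluation\<close>). Weak-star continuity makes it small on the distance
  function to some finite set \<open>A\<close> that contains the base point, so every \<open>e\<^sub>y\<close> that approximates it
  has \<open>y\<close> at a distance from \<open>A\<close> that is small relative to \<open>\<zeta> y\<close>. The estimate
  \<open>\<parallel>e\<^sub>x - e\<^sub>y\<parallel> \<le> M d(x, y) / \<zeta> x\<close> then puts one of the \<open>e\<^sub>a\<close> with \<open>a \<in> A\<close> near it.

  Now let \<open>\<phi>\<close> be such a character and \<open>e\<^sub>x\<close> be \<open>q\<close>-close to it in norm. For the tent function \<open>b\<close> with
  centre \<open>x\<close> and radius \<open>2 q \<zeta> x\<close> we have \<open>e\<^sub>x b = 2 q\<close>, so \<open>\<phi> b > 0\<close>. Conversely \<open>\<psi> b > 0\<close> forces a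
  character \<open>\<psi>\<close> to be a limit of \<open>e\<^sub>y\<close> with \<open>y\<close> in the support of \<open>b\<close>, hence to be
  \<open>2 M q\<close>-close to \<open>e\<^sub>x\<close>. So a weak-star open condition on the value at \<open>b\<close> cuts out a set inside a small norm
  ball around \<open>\<phi>\<close>.

  If the algebra has a unit, all nonzero characters take the value \<open>1\<close> there, which keeps their
  norms away from \<open>0\<close>.
\<close>

section \<open>Lipschitz functions vanishing at the base point\<close>

lemma lip0_ex:
  fixes F :: "'a::pointed_metric_space \<Rightarrow> real"
  assumes "F base_point = 0" "0 \<le> C" "\<And>x y. \<bar>F x - F y\<bar> \<le> C * dist x y"
  shows "\<exists>f. lip0_apply f = F \<and> norm f \<le> C"
proof -
  have C: "C-lipschitz_on UNIV F"
    using assms by (auto simp: lipschitz_on_def dist_real_def)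
  then have "lip0_apply (Lip0 F) = F"
    using assms(1) by (intro Lip0_inverse) auto
  moreover have "norm (Lip0 F) \<le> C"
    using Lip_least[OF C] calculation by (simp add: norm_lip0.rep_eq)
  ultimately show ?thesis by blast
qed

lemma abs_diff_lip0_le: "\<bar>lip0_apply f x - lip0_apply f y\<bar> \<le> norm f * dist x y"
  using abs_diff_le_Lip[OF lip0_lipschitz[of f], of x y] by (simp add: norm_lip0.rep_eq)

lemma lip0_apply_sum: "lip0_apply (sum f A) x = (\<Sum>i\<in>A. lip0_apply (f i) x)"
  by (induction A rule: infinite_finite_induct) (auto simp: zero_lip0.rep_eq plus_lip0.rep_eq)

lemma base_distance_ex:
  "\<exists>f :: 'a::pointed_metric_space lip0. lip0_apply f = dist base_point \<and> norm f \<le> 1"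
proof (rule lip0_ex)
  show "\<bar>dist base_point x - dist base_point y\<bar> \<le> 1 * dist x y" for x y :: 'a
    using abs_dist_diff_le[of x base_point y] by (simp add: dist_commute)
qed auto

definition base_distance :: "'a::pointed_metric_space lip0" where
  "base_distance = (SOME f. lip0_apply f = dist base_point \<and> norm f \<le> 1)"

lemma base_distance:
  "lip0_apply base_distance = dist base_point" "norm base_distance \<le> 1"
  using someI_ex[OF base_distance_ex] by (auto simp: base_distance_def)

lemma tent_ex:
  fixes x :: "'a::pointed_metric_space"
  assumes "r \<le> dist base_point x"
  shows "\<exists>f. lip0_apply f = (\<lambda>y. max 0 (r - dist x y)) \<and> norm f \<le> 1"
proof (rule lip0_ex)
  show "\<bar>max 0 (r - dist x y) - max 0 (r - dist x z)\<bar> \<le> 1 * dist y z" for y z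
    using dist_triangle[of x y z] dist_triangle[of x z y] by (auto simp: dist_commute)
qed (use assms in \<open>auto simp: dist_commute\<close>)

section \<open>Weak-star continuity and finite supports\<close>

text \<open>
  Weak-star continuity is used only through its effect on functions that vanish on a large finite
  set: a functional in the free space is a norm limit of finite combinations of evaluations.
\<close>

lemma span_delta_finite_support:
  fixes m :: "'a::pointed_metric_space lip0 \<Rightarrow>\<^sub>L real"
  assumes "m \<in> span (range delta)"
  shows "\<exists>A. finite A \<and> (\<forall>f. (\<forall>a\<in>A. lip0_apply f a = 0) \<longrightarrow> blinfun_apply m f = 0)"
  using assms
proof (induction rule: span_induct_alt)
  case base
  show ?case by (intro exI[of _ "{}"]) simp
next
  case (step c b m)
  then obtain x A where "b = delta x" "finite A"
    "\<And>f. (\<forall>a\<in>A. lip0_apply f a = 0) \<Longrightarrow> blinfun_apply m f = 0" by auto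
  then show ?case
    by (intro exI[of _ "insert x A"])
      (auto simp: blinfun.add_left blinfun.scaleR_left delta.rep_eq)
qed

lemma free_space_small_off_finite:
  fixes m :: "'a::pointed_metric_space lip0 \<Rightarrow>\<^sub>L real"
  assumes "m \<in> lipschitz_free_space" "0 < e"
  shows "\<exists>A. finite A \<and>
    (\<forall>f. norm f \<le> 1 \<longrightarrow> (\<forall>a\<in>A. lip0_apply f a = 0) \<longrightarrow> \<bar>blinfun_apply m f\<bar> < e)"
proof -
  obtain n where n: "n \<in> span (range delta)" "dist n m < e"
    using assms unfolding lipschitz_free_space_def closure_approachable by blast
  obtain A where A: "finite A"
    "\<And>f. (\<forall>a\<in>A. lip0_apply f a = 0) \<Longrightarrow> blinfun_apply n f = 0"
    using span_delta_finite_support[OF n(1)] by blast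
  have "\<bar>blinfun_apply m f\<bar> < e" if "norm f \<le> 1" "\<forall>a\<in>A. lip0_apply f a = 0" for f
  proof -
    have "\<bar>blinfun_apply m f\<bar> = norm (blinfun_apply (n - m) f)"
      using A(2)[OF that(2)] by (simp add: blinfun.diff_left)
    also have "\<dots> \<le> norm (n - m) * norm f" by (rule norm_blinfun)
    also have "\<dots> \<le> norm (n - m) * 1" using that(1) by (intro mult_left_mono) auto
    also have "\<dots> < e" using n(2) by (simp add: dist_norm)
    finally show ?thesis .
  qed
  with A(1) show ?thesis by blast
qed

text \<open>
  A basic weak-star neighbourhood of \<open>0\<close> on which \<open>\<phi>\<close> is small restricts only finitely many members
  of the free space; the finite sets belonging to these are merged.
\<close>

lemma weak_star_small_off_finite:
  fixes \<phi> :: "'a::pointed_metric_space lip0 \<Rightarrow> real"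
  assumes cont: "continuous_map lip0_weak_star euclideanreal \<phi>"
    and "\<phi> 0 = 0" "0 < e"
  shows "\<exists>A. finite A \<and>
    (\<forall>f. norm f \<le> 1 \<longrightarrow> (\<forall>a\<in>A. lip0_apply f a = 0) \<longrightarrow> \<bar>\<phi> f\<bar> < e)"
proof -
  let ?F = "lipschitz_free_space :: ('a lip0 \<Rightarrow>\<^sub>L real) set"
  let ?ev = "\<lambda>f. \<lambda>m\<in>?F. blinfun_apply m f"
  have "topspace (lip0_weak_star :: 'a lip0 topology) = UNIV"
    unfolding lip0_weak_star_def topspace_pullback_topology by auto
  then have "openin lip0_weak_star {f. \<bar>\<phi> f\<bar> < e}"
    using openin_continuous_map_preimage[OF cont, of "{-e<..<e}"] by (simp add: abs_less_iff)
      (metis (no_types, lifting) Collect_cong minus_less_iff)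
  then obtain V where V: "openin (product_topology (\<lambda>_. euclideanreal) ?F) V"
    "{f. \<bar>\<phi> f\<bar> < e} = ?ev -` V"
    unfolding lip0_weak_star_def openin_pullback_topology by auto
  have "0 \<in> {f. \<bar>\<phi> f\<bar> < e}" using assms(2,3) by simp
  then have "?ev 0 \<in> V" unfolding V(2) by (rule vimageD)
  then obtain U where U: "finite {m \<in> ?F. U m \<noteq> UNIV}" "\<forall>m\<in>?F. open (U m)"
    "?ev 0 \<in> PiE ?F U" "PiE ?F U \<subseteq> V"
    using V(1) unfolding openin_product_topology_alt by (auto simp: open_openin[symmetric])
  define J where "J = {m \<in> ?F. U m \<noteq> UNIV}"
  have "\<exists>A. finite A \<and>
      (\<forall>f. norm f \<le> 1 \<longrightarrow> (\<forall>a\<in>A. lip0_apply f a = 0) \<longrightarrow> blinfun_apply m f \<in> U m)"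
    if "m \<in> J" for m
  proof -
    have m: "m \<in> ?F" using that by (simp add: J_def)
    have "0 \<in> U m" using PiE_mem[OF U(3) m] m by (simp add: blinfun.zero_right)
    then obtain d where d: "0 < d" "ball 0 d \<subseteq> U m"
      using U(2) m open_contains_ball by blast
    obtain A where "finite A"
      "\<forall>f. norm f \<le> 1 \<longrightarrow> (\<forall>a\<in>A. lip0_apply f a = 0) \<longrightarrow> \<bar>blinfun_apply m f\<bar> < d"
      using free_space_small_off_finite[OF m d(1)] by blast
    with d(2) show ?thesis
      by (intro exI[of _ A]) (auto simp: subset_iff dist_real_def)
  qed
  then obtain A where A: "\<And>m. m \<in> J \<Longrightarrow> finite (A m)"
    "\<And>m f. \<lbrakk>m \<in> J; norm f \<le> 1; \<forall>a\<in>A m. lip0_apply f a = 0\<rbrakk> \<Longrightarrow> blinfun_apply m f \<in> U m"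
    by metis
  have "\<bar>\<phi> f\<bar> < e" if f: "norm f \<le> 1" "\<forall>a\<in>(\<Union>m\<in>J. A m). lip0_apply f a = 0" for f
  proof -
    have "blinfun_apply m f \<in> U m" if "m \<in> ?F" for m
      using A(2)[of m f] f that by (cases "m \<in> J") (auto simp: J_def)
    then have "?ev f \<in> PiE ?F U" by auto
    then have "?ev f \<in> V" using U(4) by (rule subsetD[rotated])
    then have "f \<in> {f. \<bar>\<phi> f\<bar> < e}" unfolding V(2) by (rule vimageI2)
    then show ?thesis by simp
  qed
  moreover have "finite (\<Union>m\<in>J. A m)" using U(1) A(1) by (simp add: J_def)
  ultimately show ?thesis by blast
qed

section \<open>Normalized evaluations\<close>

definition normalized_eval ::
    "(real \<Rightarrow> real) \<Rightarrow> 'a::pointed_metric_space \<Rightarrow> 'a lip0 \<Rightarrow> real" where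
  "normalized_eval \<alpha> x f = lip0_apply f x / zeta \<alpha> x"

text \<open>The parameter \<open>d\<close> is a real upper bound of \<open>D \<alpha>\<close>.\<close>

locale lipschitz_weight =
  fixes \<alpha> :: "real \<Rightarrow> real" and L d :: real
  assumes pos: "0 < t \<Longrightarrow> 0 < \<alpha> t"
    and lip: "L-lipschitz_on {0<..} \<alpha>"
    and quotient_le: "0 < t \<Longrightarrow> t / \<alpha> t \<le> d"
begin

abbreviation ev :: "'a::pointed_metric_space \<Rightarrow> 'a lip0 \<Rightarrow> real" where
  "ev \<equiv> normalized_eval \<alpha>"

abbreviation z :: "'a::pointed_metric_space \<Rightarrow> real" where
  "z \<equiv> zeta \<alpha>"

abbreviation mult :: "'a::pointed_metric_space lip0 \<Rightarrow> 'a lip0 \<Rightarrow> 'a lip0" where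
  "mult \<equiv> lip0_mult \<alpha>"

text \<open>
  The constant in the Lipschitz estimate \<open>zeta_ev_diff_le\<close> for \<open>x \<mapsto> ev x\<close>.
\<close>

definition M :: real where "M = 1 + d * L"

lemma L_nonneg: "0 \<le> L"
  using lip by (rule lipschitz_on_nonneg)

lemma d_nonneg: "0 \<le> d"
  using quotient_le[of 1] pos[of 1] by (smt (verit) divide_nonneg_pos)

lemma M_ge_1: "1 \<le> M"
  using L_nonneg d_nonneg by (simp add: M_def)

lemma D_finite: "D \<alpha> < \<infinity>"
proof -
  have "D \<alpha> \<le> ereal d"
    unfolding D_def by (rule SUP_least) (use quotient_le in auto)
  then show ?thesis by auto
qed

lemma zeta_pos: "x \<noteq> base_point \<Longrightarrow> 0 < z x"
  using pos[of "dist base_point x"] by (simp add: zeta_def)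

lemma zeta_diff_le:
  fixes x y :: "'a::pointed_metric_space"
  assumes "x \<noteq> base_point" "y \<noteq> base_point"
  shows "\<bar>z x - z y\<bar> \<le> L * dist x y"
proof -
  have "\<bar>\<alpha> (dist base_point x) - \<alpha> (dist base_point y)\<bar>
      \<le> L * \<bar>dist base_point x - dist base_point y\<bar>"
    using lipschitz_onD[OF lip, of "dist base_point x" "dist base_point y"] assms
    by (simp add: dist_real_def)
  also have "\<dots> \<le> L * dist x y"
    using abs_dist_diff_le[of x base_point y] L_nonneg
    by (intro mult_left_mono) (auto simp: dist_commute)
  finally show ?thesis using assms by (simp add: zeta_def)
qed

lemma ev_mult: "x \<noteq> base_point \<Longrightarrow> ev x (mult f g) = ev x f * ev x g"
  using lip0_apply_lip0_mult[OF pos lip D_finite, of f g x]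
  by (simp add: normalized_eval_def)

lemma ev_diff: "ev x (f - g) = ev x f - ev x g"
  by (simp add: normalized_eval_def minus_lip0.rep_eq diff_divide_distrib)

lemma ev_scaleR: "ev x (c *\<^sub>R f) = c * ev x f"
  by (simp add: normalized_eval_def scaleR_lip0.rep_eq)

lemma ev_sum: "ev x (sum f A) = (\<Sum>i\<in>A. ev x (f i))"
  by (simp add: normalized_eval_def lip0_apply_sum sum_divide_distrib)

lemma lip0_eq_of_ev:
  assumes "\<And>x. x \<noteq> base_point \<Longrightarrow> ev x f = ev x g"
  shows "f = g"
proof (rule lip0_eqI)
  fix x
  show "lip0_apply f x = lip0_apply g x"
    using assms[of x] zeta_pos[of x]
    by (cases "x = base_point") (auto simp: normalized_eval_def)
qed

lemma abs_ev_le: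
  assumes "x \<noteq> base_point"
  shows "\<bar>ev x f\<bar> \<le> norm f * ev x base_distance"
  using abs_lip0_le[of f x] zeta_pos[OF assms]
  by (simp add: normalized_eval_def base_distance abs_divide divide_right_mono)

lemma ev_base_distance_le:
  assumes "x \<noteq> base_point"
  shows "ev x base_distance \<le> d"
  using quotient_le[of "dist base_point x"] assms
  by (simp add: normalized_eval_def base_distance zeta_def)

lemma abs_ev_le':
  assumes "x \<noteq> base_point"
  shows "\<bar>ev x f\<bar> \<le> norm f * d"
  using abs_ev_le[OF assms, of f] mult_left_mono[OF ev_base_distance_le[OF assms], of "norm f"]
  by simp

text \<open>
  The quotient \<open>f / \<zeta>\<close> varies at \<open>x\<close> at a rate of order \<open>1 / \<zeta> x\<close>. Multiplying by \<open>\<zeta> x\<close> gives an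
  estimate that is uniform, also where \<open>\<zeta>\<close> is small.
\<close>

lemma zeta_ev_diff_le:
  assumes x: "x \<noteq> base_point" and y: "y \<noteq> base_point"
  shows "z x * \<bar>ev x f - ev y f\<bar> \<le> M * norm f * dist x y"
proof -
  have "z x * \<bar>ev x f - ev y f\<bar> = \<bar>z x * (ev x f - ev y f)\<bar>"
    using zeta_pos[OF x] by (simp add: abs_mult)
  also have "z x * (ev x f - ev y f)
      = (lip0_apply f x - lip0_apply f y) + ev y f * (z y - z x)"
    using zeta_pos[OF x] zeta_pos[OF y] by (simp add: normalized_eval_def field_simps)
  also have "\<bar>\<dots>\<bar> \<le> \<bar>lip0_apply f x - lip0_apply f y\<bar> + \<bar>ev y f\<bar> * \<bar>z y - z x\<bar>"
    by (metis abs_mult abs_triangle_ineq)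
  also have "\<dots> \<le> norm f * dist x y + (norm f * d) * (L * dist x y)"
    using zeta_diff_le[OF y x]
    by (intro add_mono mult_mono abs_diff_lip0_le abs_ev_le' y) (auto simp: dist_commute d_nonneg)
  also have "\<dots> = M * norm f * dist x y" by (simp add: M_def algebra_simps)
  finally show ?thesis .
qed

section \<open>Multipliers\<close>

text \<open>
  Bounds on a function \<open>U\<close> off the base point that make \<open>U f\<close> Lipschitz for every \<open>f\<close> in the algebra.
  Constants always satisfy them, so one may subtract scalars and take reciprocals without a unit in
  the algebra. The bound on differences is the one that \<open>f / \<zeta>\<close> satisfies by \<open>zeta_ev_diff_le\<close>.
\<close>

definition multiplier :: "('a::pointed_metric_space \<Rightarrow> real) \<Rightarrow> bool" where
  "multiplier U \<longleftrightarrow> (\<exists>B C. 0 \<le> B \<and> 0 \<le> C \<and> (\<forall>x y. x \<noteq> base_point \<longrightarrow> y \<noteq> base_point \<longrightarrow>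
      \<bar>U x\<bar> \<le> B \<and> z x * \<bar>U x - U y\<bar> \<le> C * dist x y))"

lemma multiplierI:
  assumes "0 \<le> B" "0 \<le> C" "\<And>x. x \<noteq> base_point \<Longrightarrow> \<bar>U x\<bar> \<le> B"
    and "\<And>x y. \<lbrakk>x \<noteq> base_point; y \<noteq> base_point\<rbrakk> \<Longrightarrow> z x * \<bar>U x - U y\<bar> \<le> C * dist x y"
  shows "multiplier U"
  using assms unfolding multiplier_def by blast

lemma multiplier_const: "multiplier (\<lambda>_. c)"
  by (rule multiplierI[of "\<bar>c\<bar>" 0]) auto

lemma multiplier_ev: "multiplier (\<lambda>x. ev x f)"
  by (rule multiplierI[of "norm f * d" "M * norm f"])
    (use d_nonneg M_ge_1 abs_ev_le' zeta_ev_diff_le in auto)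

lemma multiplier_diff:
  assumes "multiplier U" "multiplier V"
  shows "multiplier (\<lambda>x. U x - V x)"
proof -
  obtain B C where U: "0 \<le> B" "0 \<le> C" "\<And>x. x \<noteq> base_point \<Longrightarrow> \<bar>U x\<bar> \<le> B"
    "\<And>x y. \<lbrakk>x \<noteq> base_point; y \<noteq> base_point\<rbrakk> \<Longrightarrow> z x * \<bar>U x - U y\<bar> \<le> C * dist x y"
    using assms(1) unfolding multiplier_def by blast
  obtain B' C' where V: "0 \<le> B'" "0 \<le> C'" "\<And>x. x \<noteq> base_point \<Longrightarrow> \<bar>V x\<bar> \<le> B'"
    "\<And>x y. \<lbrakk>x \<noteq> base_point; y \<noteq> base_point\<rbrakk> \<Longrightarrow> z x * \<bar>V x - V y\<bar> \<le> C' * dist x y"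
    using assms(2) unfolding multiplier_def by blast
  show ?thesis
  proof (rule multiplierI[of "B + B'" "C + C'"])
    show "\<bar>U x - V x\<bar> \<le> B + B'" if "x \<noteq> base_point" for x
      using U(3)[OF that] V(3)[OF that] by linarith
    show "z x * \<bar>(U x - V x) - (U y - V y)\<bar> \<le> (C + C') * dist x y"
      if "x \<noteq> base_point" "y \<noteq> base_point" for x y
    proof -
      have "z x * \<bar>(U x - V x) - (U y - V y)\<bar> \<le> z x * (\<bar>U x - U y\<bar> + \<bar>V x - V y\<bar>)"
        using zeta_pos[OF that(1)] by (intro mult_left_mono) auto
      with U(4)[OF that] V(4)[OF that] show ?thesis by (simp add: algebra_simps)
    qed
  qed (use U V in auto)
qed

lemma multiplier_mult:
  assumes "multiplier U" "multiplier V"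
  shows "multiplier (\<lambda>x. U x * V x)"
proof -
  obtain B C where U: "0 \<le> B" "0 \<le> C" "\<And>x. x \<noteq> base_point \<Longrightarrow> \<bar>U x\<bar> \<le> B"
    "\<And>x y. \<lbrakk>x \<noteq> base_point; y \<noteq> base_point\<rbrakk> \<Longrightarrow> z x * \<bar>U x - U y\<bar> \<le> C * dist x y"
    using assms(1) unfolding multiplier_def by blast
  obtain B' C' where V: "0 \<le> B'" "0 \<le> C'" "\<And>x. x \<noteq> base_point \<Longrightarrow> \<bar>V x\<bar> \<le> B'"
    "\<And>x y. \<lbrakk>x \<noteq> base_point; y \<noteq> base_point\<rbrakk> \<Longrightarrow> z x * \<bar>V x - V y\<bar> \<le> C' * dist x y"
    using assms(2) unfolding multiplier_def by blast
  show ?thesis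
  proof (rule multiplierI[of "B * B'" "B * C' + B' * C"])
    show "\<bar>U x * V x\<bar> \<le> B * B'" if "x \<noteq> base_point" for x
      unfolding abs_mult using U(3)[OF that] V(3)[OF that] U(1) by (intro mult_mono) auto
    show "z x * \<bar>U x * V x - U y * V y\<bar> \<le> (B * C' + B' * C) * dist x y"
      if "x \<noteq> base_point" "y \<noteq> base_point" for x y
    proof -
      have "U x * V x - U y * V y = U x * (V x - V y) + V y * (U x - U y)"
        by (simp add: algebra_simps)
      then have "\<bar>U x * V x - U y * V y\<bar> \<le> \<bar>U x\<bar> * \<bar>V x - V y\<bar> + \<bar>V y\<bar> * \<bar>U x - U y\<bar>"
        by (metis abs_mult abs_triangle_ineq)
      then have "z x * \<bar>U x * V x - U y * V y\<bar>
          \<le> z x * (\<bar>U x\<bar> * \<bar>V x - V y\<bar> + \<bar>V y\<bar> * \<bar>U x - U y\<bar>)"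
        using zeta_pos[OF that(1)] by (intro mult_left_mono) auto
      also have "\<dots> = \<bar>U x\<bar> * (z x * \<bar>V x - V y\<bar>) + \<bar>V y\<bar> * (z x * \<bar>U x - U y\<bar>)"
        by (simp add: algebra_simps)
      also have "\<dots> \<le> B * (C' * dist x y) + B' * (C * dist x y)"
        using zeta_pos[OF that(1)] that
        by (intro add_mono mult_mono U V) (auto simp: U V)
      finally show ?thesis by (simp add: algebra_simps)
    qed
  qed (use U V in auto)
qed

lemma multiplier_sum: "(\<And>i. i \<in> A \<Longrightarrow> multiplier (U i)) \<Longrightarrow> multiplier (\<lambda>x. \<Sum>i\<in>A. U i x)"
proof (induction A rule: infinite_finite_induct)
  case (insert i A)
  have "multiplier (\<lambda>x. U i x - (0 - (\<Sum>i\<in>A. U i x)))"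
    using insert by (intro multiplier_diff multiplier_const) auto
  then show ?case using insert.hyps by simp
qed (auto intro: multiplier_const)

lemma multiplier_inverse:
  assumes "multiplier U" "0 < c" "\<And>x. x \<noteq> base_point \<Longrightarrow> c \<le> U x"
  shows "multiplier (\<lambda>x. 1 / U x)"
proof -
  obtain B C where U: "0 \<le> B" "0 \<le> C" "\<And>x. x \<noteq> base_point \<Longrightarrow> \<bar>U x\<bar> \<le> B"
    "\<And>x y. \<lbrakk>x \<noteq> base_point; y \<noteq> base_point\<rbrakk> \<Longrightarrow> z x * \<bar>U x - U y\<bar> \<le> C * dist x y"
    using assms(1) unfolding multiplier_def by blast
  show ?thesis
  proof (rule multiplierI[of "1 / c" "C / (c * c)"])
    show "\<bar>1 / U x\<bar> \<le> 1 / c" if "x \<noteq> base_point" for x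
      using assms(2) assms(3)[OF that] by (simp add: frac_le)
    show "z x * \<bar>1 / U x - 1 / U y\<bar> \<le> C / (c * c) * dist x y"
      if "x \<noteq> base_point" "y \<noteq> base_point" for x y
    proof -
      have p: "0 < U x" "0 < U y" using assms(2,3) that by (smt (verit))+
      have "1 / U x - 1 / U y = (U y - U x) / (U x * U y)"
        using p by (simp add: field_simps)
      then have "z x * \<bar>1 / U x - 1 / U y\<bar> = (z x * \<bar>U x - U y\<bar>) / (U x * U y)"
        using p by (simp add: abs_mult abs_minus_commute)
      also have "\<dots> \<le> (C * dist x y) / (c * c)"
      proof (rule frac_le)
        show "z x * \<bar>U x - U y\<bar> \<le> C * dist x y" by (rule U(4)[OF that])
        show "c * c \<le> U x * U y"
          using assms(2,3) p that by (intro mult_mono) auto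
      qed (use U(2) assms(2) in auto)
      finally show ?thesis by simp
    qed
  qed (use U assms(2) in auto)
qed

lemma multiplier_acts:
  assumes "multiplier U"
  shows "\<exists>g. \<forall>x. x \<noteq> base_point \<longrightarrow> ev x g = U x * ev x f"
proof -
  obtain B C where U: "0 \<le> B" "0 \<le> C" "\<And>x. x \<noteq> base_point \<Longrightarrow> \<bar>U x\<bar> \<le> B"
    "\<And>x y. \<lbrakk>x \<noteq> base_point; y \<noteq> base_point\<rbrakk> \<Longrightarrow> z x * \<bar>U x - U y\<bar> \<le> C * dist x y"
    using assms unfolding multiplier_def by blast
  let ?F = "\<lambda>x. if x = base_point then 0 else U x * lip0_apply f x"
  \<comment> \<open>The second summand absorbs the variation of \<open>U\<close>: it is weighted by \<open>f y = ev y f * z y\<close>, and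
    \<open>\<bar>ev y f\<bar>\<close> is at most \<open>norm f * d\<close>.\<close>
  let ?C = "B * norm f + norm f * d * C"
  have C0: "0 \<le> ?C" using U d_nonneg by simp
  have base: "\<bar>?F x\<bar> \<le> ?C * dist base_point x" for x
  proof (cases "x = base_point")
    case False
    then have "\<bar>?F x\<bar> \<le> B * (norm f * dist base_point x)"
      using U by (simp add: abs_mult) (intro mult_mono abs_lip0_le, auto)
    also have "\<dots> \<le> ?C * dist base_point x"
      using U d_nonneg by (simp add: algebra_simps)
    finally show ?thesis .
  qed simp
  have "\<exists>g. lip0_apply g = ?F \<and> norm g \<le> ?C"
  proof (rule lip0_ex[OF _ C0])
    fix x y
    show "\<bar>?F x - ?F y\<bar> \<le> ?C * dist x y"
    proof (cases "x = base_point \<or> y = base_point")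
      case True
      then show ?thesis using base[of x] base[of y] by (auto simp: dist_commute)
    next
      case False
      then have x: "x \<noteq> base_point" and y: "y \<noteq> base_point" by auto
      have f_y: "lip0_apply f y = ev y f * z y"
        using zeta_pos[OF y] by (simp add: normalized_eval_def)
      have "?F x - ?F y
          = U x * (lip0_apply f x - lip0_apply f y) - ev y f * (z y * (U y - U x))"
        using x y by (simp add: f_y algebra_simps)
      also have "\<bar>\<dots>\<bar> \<le> \<bar>U x * (lip0_apply f x - lip0_apply f y)\<bar>
          + \<bar>ev y f * (z y * (U y - U x))\<bar>"
        by (rule abs_triangle_ineq4)
      also have "\<dots> = \<bar>U x\<bar> * \<bar>lip0_apply f x - lip0_apply f y\<bar>
          + \<bar>ev y f\<bar> * (z y * \<bar>U y - U x\<bar>)"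
        using zeta_pos[OF y] by (simp add: abs_mult)
      also have "\<dots> \<le> B * (norm f * dist x y) + norm f * d * (C * dist y x)"
        using zeta_pos[OF y] d_nonneg
        by (intro add_mono mult_mono U abs_diff_lip0_le abs_ev_le' x y) (auto simp: U)
      also have "\<dots> = ?C * dist x y" by (simp add: dist_commute algebra_simps)
      finally show ?thesis .
    qed
  qed simp
  then obtain g where "lip0_apply g = ?F" by blast
  then show ?thesis by (intro exI[of _ g]) (auto simp: normalized_eval_def)
qed

section \<open>Every character is a pointwise limit of normalized evaluations\<close>

text \<open>
  Closure under inverses enters in this form: for \<open>h\<close> in the algebra and a multiplier \<open>u\<close> that is
  bounded below by a positive constant, \<open>h / u\<close> is again in the algebra.
\<close>

lemma character_approx:
  fixes \<phi> :: "'a::pointed_metric_space lip0 \<Rightarrow> real"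
  assumes "\<phi> \<in> Delta \<alpha>" "finite G" "0 < e"
  shows "\<exists>x. x \<noteq> base_point \<and> (\<forall>f\<in>G. \<bar>ev x f - \<phi> f\<bar> < e)"
proof (rule ccontr)
  assume contra: "\<nexists>x. x \<noteq> base_point \<and> (\<forall>f\<in>G. \<bar>ev x f - \<phi> f\<bar> < e)"
  have lin: "linear \<phi>" and mul: "\<And>f g. \<phi> (mult f g) = \<phi> f * \<phi> g" and nz: "\<phi> \<noteq> (\<lambda>_. 0)"
    using assms(1) by (auto simp: Delta_def)
  obtain h where h: "\<phi> h \<noteq> 0" using nz by auto
  define u where "u x = (\<Sum>f\<in>G. (ev x f - \<phi> f) * (ev x f - \<phi> f))" for x :: 'a
  define T where "T f k = mult k f - \<phi> f *\<^sub>R k" for f k :: "'a lip0"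
  \<comment> \<open>\<open>T f\<close> multiplies by \<open>f / \<zeta> - \<phi> f\<close>, so \<open>\<phi>\<close> vanishes on its range; \<open>w\<close> is \<open>h\<close> times \<open>u\<close>.\<close>
  define w where "w = (\<Sum>f\<in>G. T f (T f h))"
  have u_ge: "e * e \<le> u x" if x: "x \<noteq> base_point" for x
  proof -
    obtain f where f: "f \<in> G" "e \<le> \<bar>ev x f - \<phi> f\<bar>"
      using contra x by (meson not_less)
    have "e * e \<le> \<bar>ev x f - \<phi> f\<bar> * \<bar>ev x f - \<phi> f\<bar>"
      using f assms(3) by (intro mult_mono) auto
    also have "\<dots> = (ev x f - \<phi> f) * (ev x f - \<phi> f)" by (simp flip: abs_mult)
    also have "\<dots> \<le> u x"
      unfolding u_def by (rule member_le_sum[OF f(1) _ assms(2)]) auto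
    finally show ?thesis .
  qed
  have "multiplier u"
    unfolding u_def
    by (intro multiplier_sum multiplier_mult multiplier_diff multiplier_ev multiplier_const)
  then have "multiplier (\<lambda>x. 1 / u x)"
    by (rule multiplier_inverse[of _ "e * e"]) (use assms(3) u_ge in auto)
  then obtain v where v: "\<And>x. x \<noteq> base_point \<Longrightarrow> ev x v = 1 / u x * ev x h"
    using multiplier_acts by blast
  have "ev x (T f k) = ev x k * (ev x f - \<phi> f)" if "x \<noteq> base_point" for x f k
    using that by (simp add: T_def ev_diff ev_scaleR ev_mult algebra_simps)
  then have w: "ev x w = ev x h * u x" if "x \<noteq> base_point" for x
    using that by (simp add: w_def ev_sum u_def sum_distrib_left mult.assoc)
  have "mult w v = mult h h"
  proof (rule lip0_eq_of_ev)
    fix x :: 'a assume x: "x \<noteq> base_point"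
    have "0 < u x" using u_ge[OF x] assms(3) by (smt (verit) mult_pos_pos)
    then show "ev x (mult w v) = ev x (mult h h)"
      by (simp add: ev_mult x w v)
  qed
  then have "\<phi> h * \<phi> h = \<phi> w * \<phi> v" by (metis mul)
  moreover have "\<phi> (T f k) = 0" for f k
    by (simp add: T_def linear_diff[OF lin] linear_scale[OF lin] mul)
  then have "\<phi> w = 0" by (simp add: w_def linear_sum[OF lin])
  ultimately show False using h by simp
qed

text \<open>
  For normalized evaluations this is the Lipschitz estimate between \<open>x\<close> and the base point. In
  particular the norm of a character is at most its value at the distance function.
\<close>

lemma character_le_base_distance:
  assumes "\<phi> \<in> Delta \<alpha>"
  shows "\<bar>\<phi> f\<bar> \<le> norm f * \<phi> base_distance"
proof (rule field_le_epsilon)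
  fix e :: real assume "0 < e"
  define r where "r = e / (1 + norm f)"
  have r: "0 < r" "(1 + norm f) * r = e" using \<open>0 < e\<close>
    by (auto simp: r_def add_pos_nonneg add_nonneg_eq_0_iff)
  obtain x where x: "x \<noteq> base_point" "\<bar>ev x f - \<phi> f\<bar> < r"
    "\<bar>ev x base_distance - \<phi> base_distance\<bar> < r"
    using character_approx[OF assms, of "{f, base_distance}" r] r by auto
  have "\<bar>\<phi> f\<bar> \<le> \<bar>ev x f\<bar> + r" using x(2) by linarith
  also have "\<dots> \<le> norm f * ev x base_distance + r" using abs_ev_le[OF x(1)] by simp
  also have "\<dots> \<le> norm f * (\<phi> base_distance + r) + r"
    using x(3) by (intro add_right_mono mult_left_mono) auto
  also have "\<dots> = norm f * \<phi> base_distance + e" using r(2) by (simp add: algebra_simps)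
  finally show "\<bar>\<phi> f\<bar> \<le> norm f * \<phi> base_distance + e" .
qed

lemma character_base_distance_pos:
  assumes "\<phi> \<in> Delta \<alpha>"
  shows "0 < \<phi> base_distance"
proof -
  have "\<phi> \<noteq> (\<lambda>_. 0)" using assms by (simp add: Delta_def)
  then obtain f where "\<phi> f \<noteq> 0" by auto
  then have "0 < norm f * \<phi> base_distance"
    using character_le_base_distance[OF assms, of f] by linarith
  then show ?thesis by (simp add: zero_less_mult_iff)
qed

section \<open>Localization\<close>

text \<open>
  If \<open>\<psi> b > 0\<close>, the evaluations that approximate \<open>\<psi>\<close> are positive on \<open>b\<close>, that is, they belong to
  points at distance less than \<open>r\<close> from \<open>x\<close>.
\<close>

lemma character_near_point:
  fixes x :: "'a::pointed_metric_space"
  assumes "\<psi> \<in> Delta \<alpha>" "x \<noteq> base_point"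
    and tent: "lip0_apply b = (\<lambda>y. max 0 (r - dist x y))" and "0 < \<psi> b"
  shows "\<bar>\<psi> g - ev x g\<bar> \<le> M * norm g * (r / z x)"
proof (rule field_le_epsilon)
  fix e :: real assume "0 < e"
  then have e: "0 < min e (\<psi> b)" using assms(4) by simp
  obtain y where y: "y \<noteq> base_point" "\<bar>ev y g - \<psi> g\<bar> < min e (\<psi> b)"
    "\<bar>ev y b - \<psi> b\<bar> < min e (\<psi> b)"
    using character_approx[OF assms(1), of "{g, b}", OF _ e] by auto
  have "0 < ev y b" using y(3) by linarith
  then have "dist x y < r"
    using zeta_pos[OF y(1)] by (auto simp: normalized_eval_def tent zero_less_divide_iff max_def split: if_splits)
  have "z x * \<bar>ev x g - ev y g\<bar> \<le> M * norm g * dist x y"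
    by (rule zeta_ev_diff_le[OF assms(2) y(1)])
  also have "\<dots> \<le> M * norm g * r"
    using \<open>dist x y < r\<close> M_ge_1 by (intro mult_left_mono) auto
  finally have "\<bar>ev x g - ev y g\<bar> \<le> M * norm g * (r / z x)"
    using zeta_pos[OF assms(2)] by (simp add: field_simps)
  then show "\<bar>\<psi> g - ev x g\<bar> \<le> M * norm g * (r / z x) + e"
    using y(2) by linarith
qed

text \<open>
  Which point of the finite set \<open>A\<close> is close to \<open>y\<close> depends on the approximating evaluation \<open>ev y\<close>.
  Arguing by contradiction avoids this dependence: if no \<open>ev a\<close> is close to \<open>\<phi>\<close>, each comes with a
  function \<open>g a\<close> that witnesses it, and \<open>ev y\<close> is chosen to approximate \<open>\<phi>\<close> at all \<open>g a\<close> at once.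
\<close>

lemma weak_star_character_near_evaluation:
  fixes \<phi> :: "'a::pointed_metric_space lip0 \<Rightarrow> real"
  assumes phi: "\<phi> \<in> Delta \<alpha>" and cont: "continuous_map lip0_weak_star euclideanreal \<phi>"
    and "0 < e"
  shows "\<exists>x. x \<noteq> base_point \<and> (\<forall>g. \<bar>\<phi> g - ev x g\<bar> \<le> e * norm g)"
proof (rule ccontr)
  assume contra: "\<not> ?thesis"
  have lin: "linear \<phi>" using phi by (simp add: Delta_def)
  have "\<exists>g. norm g = 1 \<and> e < \<bar>\<phi> g - ev x g\<bar>" if "x \<noteq> base_point" for x
  proof -
    obtain g where g: "e * norm g < \<bar>\<phi> g - ev x g\<bar>" using contra \<open>x \<noteq> base_point\<close> by (auto simp: not_le)
    have n: "norm g \<noteq> 0"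
      using g linear_0[OF lin] by (auto simp: normalized_eval_def zero_lip0.rep_eq)
    define c where "c = inverse (norm g)"
    have c: "0 < c" "c * norm g = 1" using n by (auto simp: c_def)
    have "\<phi> (c *\<^sub>R g) - ev x (c *\<^sub>R g) = c * (\<phi> g - ev x g)"
      by (simp add: linear_scale[OF lin] ev_scaleR algebra_simps)
    then have "\<bar>\<phi> (c *\<^sub>R g) - ev x (c *\<^sub>R g)\<bar> = c * \<bar>\<phi> g - ev x g\<bar>"
      using c(1) by (simp add: abs_mult)
    also have "\<dots> > c * (e * norm g)"
      by (rule mult_strict_left_mono[OF g c(1)])
    also have "c * (e * norm g) = e" using c(2) by (simp add: mult.left_commute)
    finally show ?thesis using c by (intro exI[of _ "c *\<^sub>R g"]) auto
  qed
  then obtain g where g: "\<And>x. x \<noteq> base_point \<Longrightarrow> norm (g x) = 1"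
    "\<And>x. x \<noteq> base_point \<Longrightarrow> e < \<bar>\<phi> (g x) - ev x (g x)\<bar>" by metis
  define k where "k = \<phi> base_distance"
  \<comment> \<open>The bound \<open>k / 3\<close> keeps \<open>y\<close> away from the base point, so that the point of \<open>A\<close> near \<open>y\<close> carries
    an evaluation; the bound \<open>e / (4 * M)\<close> makes that evaluation differ from \<open>ev y\<close> by at most \<open>e / 2\<close>.\<close>
  define r where "r = min (k / 3) (e / (4 * M))"
  have k: "0 < k" using character_base_distance_pos[OF phi] by (simp add: k_def)
  have r: "0 < r" "3 * r \<le> k" "4 * M * r \<le> e"
    using k assms(3) M_ge_1 by (auto simp: r_def min_def field_simps)
  obtain A where A: "finite A"
    "\<And>f. \<lbrakk>norm f \<le> 1; \<forall>a\<in>A. lip0_apply f a = 0\<rbrakk> \<Longrightarrow> \<bar>\<phi> f\<bar> < r"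
    using weak_star_small_off_finite[OF cont linear_0[OF lin] r(1)] by blast
  let ?A = "insert base_point A"
  obtain f where f: "lip0_apply f = (\<lambda>y. infdist y ?A)" "norm f \<le> 1"
  proof -
    have "\<exists>f. lip0_apply f = (\<lambda>y. infdist y ?A) \<and> norm f \<le> 1"
      by (rule lip0_ex) (auto simp: infdist_triangle_abs)
    then show thesis using that by blast
  qed
  have fr: "\<bar>\<phi> f\<bar> < r" by (rule A(2)[OF f(2)]) (simp add: f(1))
  have r2: "0 < min r (e / 2)" using r(1) assms(3) by simp
  have "finite (insert f (insert base_distance (g ` A)))" using A(1) by simp
  from character_approx[OF phi this r2] obtain y where y: "y \<noteq> base_point"
    "\<bar>ev y f - \<phi> f\<bar> < min r (e / 2)" "\<bar>ev y base_distance - k\<bar> < min r (e / 2)"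
    "\<And>a. a \<in> A \<Longrightarrow> \<bar>ev y (g a) - \<phi> (g a)\<bar> < min r (e / 2)"
    by (auto simp: k_def)
  have "ev y f < 2 * r" using y(2) fr by linarith
  then have "infdist y ?A < 2 * r * z y"
    using zeta_pos[OF y(1)] by (simp add: normalized_eval_def f(1) field_simps)
  moreover have "infdist y ?A = (INF a\<in>?A. dist y a)" by (rule infdist_notempty) simp
  ultimately have "(INF a\<in>?A. dist y a) < 2 * r * z y" by (simp only:)
  then obtain a where a: "a \<in> ?A" "dist y a < 2 * r * z y"
    by (subst (asm) cINF_less_iff) auto
  have "a \<noteq> base_point"
  proof
    assume "a = base_point"
    then have "ev y base_distance < 2 * r"
      using a(2) zeta_pos[OF y(1)]
      by (simp add: normalized_eval_def base_distance dist_commute field_simps)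
    then show False using y(3) r(2) by linarith
  qed
  then have aA: "a \<in> A" using a(1) by simp
  have "z y * \<bar>ev y (g a) - ev a (g a)\<bar> \<le> M * norm (g a) * dist y a"
    by (rule zeta_ev_diff_le[OF y(1) \<open>a \<noteq> base_point\<close>])
  also have "\<dots> \<le> M * (2 * r * z y)"
    using a(2) M_ge_1 g(1)[OF \<open>a \<noteq> base_point\<close>] by simp
  finally have "\<bar>ev y (g a) - ev a (g a)\<bar> \<le> 2 * M * r"
    using zeta_pos[OF y(1)] by (simp add: field_simps)
  then show False
    using g(2)[OF \<open>a \<noteq> base_point\<close>] y(4)[OF aA] r(3) by linarith
qed

section \<open>Weak-star neighbourhoods inside norm balls\<close>

text \<open>
  One function \<open>f\<close> is enough: the distance to the base point at \<open>\<phi> = 0\<close>, and a narrow tent function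
  at any other \<open>\<phi>\<close>.
\<close>

lemma weak_star_neighbourhood_in_ball:
  fixes \<phi> :: "'a::pointed_metric_space lip0 \<Rightarrow>\<^sub>L real"
  assumes "\<phi> \<in> Delta0_star \<alpha>" "0 < e"
  shows "\<exists>f U. open U \<and> blinfun_apply \<phi> f \<in> U \<and>
    (\<forall>\<psi>\<in>Delta0_star \<alpha>. blinfun_apply \<psi> f \<in> U \<longrightarrow> dist \<psi> \<phi> < e)"
proof (cases "blinfun_apply \<phi> = (\<lambda>_. 0)")
  case True
  then have phi0: "\<phi> = 0" by (intro blinfun_eqI) simp
  have "dist \<psi> \<phi> < e"
    if psi: "\<psi> \<in> Delta0_star \<alpha>" "blinfun_apply \<psi> base_distance \<in> {..<e}" for \<psi>
  proof (cases "blinfun_apply \<psi> \<in> Delta \<alpha>")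
    case True
    have "norm \<psi> \<le> blinfun_apply \<psi> base_distance"
      using character_le_base_distance[OF True] character_base_distance_pos[OF True]
      by (intro norm_blinfun_bound) (auto simp: mult.commute)
    with psi(2) show ?thesis by (simp add: phi0)
  next
    case False
    then have "blinfun_apply \<psi> = (\<lambda>_. 0)"
      using psi(1) by (auto simp: Delta0_star_def Delta0_def)
    then have "\<psi> = 0" by (intro blinfun_eqI) simp
    then show ?thesis using assms(2) phi0 by simp
  qed
  then show ?thesis
    using assms(2) phi0 by (intro exI[of _ base_distance] exI[of _ "{..<e}"]) auto
next
  case False
  then have phi: "blinfun_apply \<phi> \<in> Delta \<alpha>"
    "continuous_map lip0_weak_star euclideanreal (blinfun_apply \<phi>)"
    using assms(1) by (auto simp: Delta0_star_def Delta0_def)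
  define k where "k = blinfun_apply \<phi> base_distance"
  \<comment> \<open>The tent of radius \<open>2 * q * z x\<close> vanishes at the base point because \<open>q \<le> k / 3\<close>. Through its
    centre \<open>ev x\<close> the distance to \<open>\<phi>\<close> is at most \<open>2 * M * q + q\<close>, which the other bound puts below \<open>e\<close>.\<close>
  define q where "q = min (k / 3) (e / (2 * (2 * M + 1)))"
  have k: "0 < k" using character_base_distance_pos[OF phi(1)] by (simp add: k_def)
  have q: "0 < q" "3 * q \<le> k" "(2 * M + 1) * q < e"
  proof -
    have M: "0 < 2 * M + 1" using M_ge_1 by simp
    show "0 < q" "3 * q \<le> k" using k assms(2) M by (auto simp: q_def)
    have "(2 * M + 1) * q \<le> (2 * M + 1) * (e / (2 * (2 * M + 1)))"
      using M by (intro mult_left_mono) (auto simp: q_def)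
    also have "\<dots> = e / 2" using M by (simp add: field_simps)
    also have "\<dots> < e" using assms(2) by simp
    finally show "(2 * M + 1) * q < e" .
  qed
  obtain x where x: "x \<noteq> base_point" "\<And>g. \<bar>blinfun_apply \<phi> g - ev x g\<bar> \<le> q * norm g"
    using weak_star_character_near_evaluation[OF phi q(1)] by blast
  have z: "0 < z x" by (rule zeta_pos[OF x(1)])
  have small: "q * norm g \<le> q" if "norm g \<le> 1" for g :: "'a lip0"
    using q(1) that by (simp add: mult_left_le)
  have "2 * q \<le> ev x base_distance"
    using x(2)[of base_distance] small[OF base_distance(2)] q(2) unfolding k_def by linarith
  then have "2 * q * z x \<le> dist base_point x"
    using z by (simp add: normalized_eval_def base_distance field_simps)
  then obtain b where b: "lip0_apply b = (\<lambda>y. max 0 (2 * q * z x - dist x y))" "norm b \<le> 1"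
    using tent_ex by blast
  have "ev x b = 2 * q" using z q(1) by (simp add: normalized_eval_def b(1))
  then have pos_b: "0 < blinfun_apply \<phi> b"
    using x(2)[of b] small[OF b(2)] q(1) by linarith
  have "dist \<psi> \<phi> < e"
    if psi: "\<psi> \<in> Delta0_star \<alpha>" "blinfun_apply \<psi> b \<in> {0<..}" for \<psi>
  proof -
    have "blinfun_apply \<psi> \<in> Delta \<alpha>"
      using psi by (auto simp: Delta0_star_def Delta0_def)
    from character_near_point[OF this x(1) b(1)] psi(2) z
    have near: "\<bar>blinfun_apply \<psi> g - ev x g\<bar> \<le> M * norm g * (2 * q)" for g by simp
    have "norm (\<psi> - \<phi>) \<le> (2 * M + 1) * q"
    proof (rule norm_blinfun_bound)
      show "norm (blinfun_apply (\<psi> - \<phi>) g) \<le> (2 * M + 1) * q * norm g" for g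
        using near[of g] x(2)[of g] by (simp add: blinfun.diff_left algebra_simps)
    qed (use q(1) M_ge_1 in auto)
    with q(3) show ?thesis by (simp add: dist_norm)
  qed
  then show ?thesis
    using pos_b by (intro exI[of _ b] exI[of _ "{0<..}"]) auto
qed

lemma weak_star_eq_norm_topology:
  "subtopology dual_weak_star (Delta0_star \<alpha> :: ('a::pointed_metric_space lip0 \<Rightarrow>\<^sub>L real) set)
    = subtopology euclidean (Delta0_star \<alpha>)"
proof -
  let ?S = "Delta0_star \<alpha> :: ('a lip0 \<Rightarrow>\<^sub>L real) set"
  have "openin (subtopology dual_weak_star ?S) W" if "openin (top_of_set ?S) W" for W
  proof (subst openin_subopen, intro ballI)
    fix \<phi> assume "\<phi> \<in> W"
    from that obtain V where V: "open V" "W = ?S \<inter> V" unfolding openin_open by blast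
    then obtain e where e: "0 < e" "ball \<phi> e \<subseteq> V"
      using \<open>\<phi> \<in> W\<close> open_contains_ball by blast
    have "\<phi> \<in> ?S" using \<open>\<phi> \<in> W\<close> V(2) by simp
    then obtain f U where U: "open U" "blinfun_apply \<phi> f \<in> U"
      "\<forall>\<psi>\<in>?S. blinfun_apply \<psi> f \<in> U \<longrightarrow> dist \<psi> \<phi> < e"
      using weak_star_neighbourhood_in_ball[OF \<open>\<phi> \<in> ?S\<close> e(1)] by blast
    have "openin dual_weak_star
        {\<psi> \<in> topspace dual_weak_star. blinfun_apply \<psi> f \<in> U}"
      by (rule openin_continuous_map_preimage[OF strong_operator_topology_continuous_evaluation])
        (use U(1) in simp)
    then have "openin (subtopology dual_weak_star ?S) ({\<psi>. blinfun_apply \<psi> f \<in> U} \<inter> ?S)"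
      unfolding strong_operator_topology_topspace openin_subtopology by auto
    moreover have "{\<psi>. blinfun_apply \<psi> f \<in> U} \<inter> ?S \<subseteq> W"
      using U(3) e(2) V(2) by (auto simp: subset_iff dist_commute)
    ultimately show "\<exists>T. openin (subtopology dual_weak_star ?S) T \<and> \<phi> \<in> T \<and> T \<subseteq> W"
      using U(2) \<open>\<phi> \<in> ?S\<close> by blast
  qed
  moreover have "openin (top_of_set ?S) W" if "openin (subtopology dual_weak_star ?S) W" for W
    using that strong_operator_topology_weaker_than_euclidean
    unfolding openin_subtopology continuous_map_def by force
  ultimately show ?thesis unfolding topology_eq by blast
qed

end

section \<open>The unital case\<close>

lemma zero_isolated_if_unit:
  assumes "has_natural_unit TYPE('a::pointed_metric_space) \<alpha>"
  shows "(0 :: 'a lip0 \<Rightarrow>\<^sub>L real) isolated_in Delta0_star \<alpha>"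
proof -
  obtain u :: "'a lip0" where u: "\<And>f. lip0_mult \<alpha> u f = f"
    using assms unfolding has_natural_unit_def by blast
  have "\<psi> = 0" if "\<psi> \<in> Delta0_star \<alpha>" "\<psi> \<in> ball 0 (1 / (1 + norm u))"
    for \<psi> :: "'a lip0 \<Rightarrow>\<^sub>L real"
  proof (rule ccontr)
    assume "\<psi> \<noteq> 0"
    then obtain f where f: "blinfun_apply \<psi> f \<noteq> 0"
      using blinfun_eqI[of \<psi> 0] by (metis blinfun.zero_left)
    then have "blinfun_apply \<psi> \<in> Delta \<alpha>"
      using that(1) by (auto simp: Delta0_star_def Delta0_def)
    then have "blinfun_apply \<psi> (lip0_mult \<alpha> u f) = blinfun_apply \<psi> u * blinfun_apply \<psi> f"
      by (simp add: Delta_def)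
    with f u[of f] have "1 = norm (blinfun_apply \<psi> u)" by simp
    also have "\<dots> \<le> norm \<psi> * norm u" by (rule norm_blinfun)
    also have "\<dots> \<le> norm \<psi> * (1 + norm u)" by (intro mult_left_mono) auto
    also have "\<dots> < 1"
      using that(2) by (simp add: pos_less_divide_eq add_pos_nonneg)
    finally show False by simp
  qed
  moreover have "(0 :: 'a lip0 \<Rightarrow>\<^sub>L real) \<in> Delta0_star \<alpha>"
  proof -
    have "blinfun_apply (0 :: 'a lip0 \<Rightarrow>\<^sub>L real) = (\<lambda>_. 0)" by auto
    then show ?thesis by (simp add: Delta0_star_def Delta0_def)
  qed
  ultimately have "ball 0 (1 / (1 + norm u)) \<inter> Delta0_star \<alpha> = {0 :: 'a lip0 \<Rightarrow>\<^sub>L real}"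
    by (auto simp: add_pos_nonneg)
  with open_ball show ?thesis unfolding isolated_in_def by blast
qed

section \<open>Coincidence of the topologies\<close>

text \<open>
  As \<open>K \<alpha> + 2\<close> is positive, an infinite \<open>D \<alpha>\<close> would make the product infinite.
\<close>

lemma D_finite_of_product_le:
  assumes pos: "\<And>t. 0 < t \<Longrightarrow> 0 < \<alpha> t" and lip: "L-lipschitz_on {0<..} \<alpha>"
    and le: "D \<alpha> * (K \<alpha> + 2) \<le> 1"
  shows "D \<alpha> < \<infinity>"
proof (rule ccontr)
  assume "\<not> D \<alpha> < \<infinity>"
  then have D: "D \<alpha> = \<infinity>" by simp
  have "0 \<le> Lip {0<..} \<alpha>" by (rule Lip_nonneg[OF lip]) auto
  then have "0 \<le> K \<alpha>" by (simp add: K_def D)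
  with D le show False by (cases "K \<alpha>") auto
qed

theorem theorem5p12:
  fixes \<alpha> :: "real \<Rightarrow> real"
  assumes "\<And>t. 0 < t \<Longrightarrow> 0 < \<alpha> t"
    and "\<exists>L. L-lipschitz_on {0<..} \<alpha>"
    and "D \<alpha> * (K \<alpha> + 2) \<le> 1"
  shows "subtopology dual_weak_star
      (Delta0_star \<alpha> :: ('a::pointed_metric_space lip0 \<Rightarrow>\<^sub>L real) set)
      = subtopology euclidean (Delta0_star \<alpha>)
    \<and> (has_natural_unit TYPE('a) \<alpha> \<longrightarrow>
        (0 :: 'a lip0 \<Rightarrow>\<^sub>L real) isolated_in Delta0_star \<alpha>)"
proof -
  obtain L where L: "L-lipschitz_on {0<..} \<alpha>" using assms(2) by blast
  have fin: "D \<alpha> < \<infinity>" by (rule D_finite_of_product_le[OF assms(1) L assms(3)])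
  have quot: "ereal (t / \<alpha> t) \<le> D \<alpha>" if "0 < t" for t
    unfolding D_def by (rule SUP_upper) (use that in simp)
  then obtain d where d: "D \<alpha> = ereal d" using fin quot[of 1] by (cases "D \<alpha>") auto
  interpret lipschitz_weight \<alpha> L d
    by standard (use assms(1) L quot d in auto)
  show ?thesis
    using weak_star_eq_norm_topology zero_isolated_if_unit by blast
qed

end
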